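(* Let $(L=\frac12 g,\mathcal D)$ be a purely kinetic nonholonomic system on $Q$, let $F\in C^\infty(Q)$, and let $\hat g=e^{2F}\overline g$ be a pseudo-Riemannian metric on $Q$ which is a $\mathcal D$-conformal modification of the Riemannian metric $g$ (so $\overline g$ is a $\mathcal D$-preserving modification of $g$). Assume that $\overline g|_{\mathcal D^{\overline g}\times\mathcal D^{\overline g}}$ is non-degenerate, where $\mathcal D^{\overline g}$ is the orthogonal of $\mathcal D$ with respect to $\overline g$. Let $\{X_a,X_i\}$ be a local frame with $X_a$ spanning $\mathcal D$ and $X_i$ spanning $\mathcal D^g$. Then the conditions $$\begin{cases}\Gamma^a_{bc}v^bv^c=\overline\Gamma^a_{bc}v^bv^c+X_c(F)v^cv^a-g_{bc}\,\overline g^{\alpha a}X_\alpha(F)v^bv^c,\\ 0=\overline\Gamma^i_{bc}v^bv^c-g_{bc}\,\overline g^{\alpha i}X_\alpha(F)v^bv^c\end{cases}$$ (for all $a$, all $i$ and all values of $(v^a)$) are equivalent to the two conditions $$(A')\quad g_{bd}\left(\delta_a^dX_c(F)-\delta_c^dX_a(F)\right)v^av^b+\theta_kR^k_{ac}v^a=0\quad\text{for all } c,$$ $$(B')\quad \Gamma^{nh}(\theta_i)+\lambda_i+\theta_k\left(R^k_{ia}+\delta^k_iX_a(F)\right)v^a-g_{ab}X_i(F)v^av^b=0\quad\text{for all } i,$$ (for all values of $(v^a)$), where $\theta_i=\overline g_{ai}v^a$.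
   Context: Setting: $Q$ is an $n$-dimensional manifold with Riemannian metric $g$; $\mathcal D\subset TQ$ is a distribution of rank $m$; $k=n-m$; $L(v)=\frac12 g(v,v)$; $\mathcal D^g$ is the $g$-orthogonal complement of $\mathcal D$. Indices: $a,b,c,d,e=1,\dots,m$; $i,j,k=1,\dots,n-m$; Greek indices run over both. Summation convention is used. In a local frame $\{X_\alpha\}=\{X_a,X_i\}$ with $X_a$ spanning $\mathcal D$ and $X_i$ spanning $\mathcal D^g$, write $[X_\alpha,X_\beta]=R^\gamma_{\alpha\beta}X_\gamma$, $g_{ab}=g(X_a,X_b)$, $g_{ij}=g(X_i,X_j)$ (and $g(X_a,X_i)=0$). Any tangent vector is $v=v^aX_a+v^iX_i$, and the $v^\alpha$ are its quasi-velocities; $\mathcal D$ is given by $v^i=0$. Let $\nabla$, $\overline\nabla$ be the Levi-Civita connections of $g$, $\overline g$ and write $\nabla_{X_a}X_b=\Gamma^c_{ab}X_c+\Gamma^i_{ab}X_i$, $\overline\nabla_{X_a}X_b=\overline\Gamma^c_{ab}X_c+\overline\Gamma^i_{ab}X_i$. Write $\overline g_{\alpha\beta}=\overline g(X_\alpha,X_\beta)$, with inverse matrix $\overline g^{\alpha\beta}$. A symmetric $(0,2)$-tensor field $\overline g$ is a $\mathcal D$-preserving modification of $g$ if $\overline g|_{\mathcal D\times\mathcal D}=g|_{\mathcal D\times\mathcal D}$. A symmetric $(0,2)$-tensor field $\hat g$ is a $\mathcal D$-conformal modification of $g$ if $\hat g=e^{2F}\overline g$ with $F\in C^\infty(Q)$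 and $\overline g$ a $\mathcal D$-preserving modification of $g$. The nonholonomic vector field $\Gamma^{nh}$ is the vector field on the manifold $\mathcal D$ whose integral curves satisfy $\dot q=v^aX_a(q)$, $\dot v^d=-\Gamma^d_{ab}v^av^b$ (Lagrange–d'Alembert equations). Thus for a function $\theta=\theta_b(q)v^b$ on $\mathcal D$: $\Gamma^{nh}(\theta)=(X_a(\theta_b)-\theta_d\Gamma^d_{ab})v^av^b$. The Lagrange multipliers are $\lambda_i=g_{ki}\Gamma^k_{ab}v^av^b$. *)

theory Defs
  imports "HOL-Analysis.Analysis" "HOL-Library.Function_Algebras"
begin

section \<open>Real-valued functions as a real vector space\<close>

text \<open>
  Tangent vectors are represented below as functionals, so this instance makes the library notions
  \<^const>\<open>subspace\<close>, \<^const>\<open>span\<close>, \<^const>\<open>independent\<close>, \<^const>\<open>dim\<close> and \<^const>\<open>representation\<close>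
  applicable to them.
\<close>

instantiation "fun" :: (type, scaleR) scaleR
begin

definition scaleR_fun_def: "scaleR r f = (\<lambda>x. scaleR r (f x))"

instance ..

end

instance "fun" :: (type, real_vector) real_vector
  by standard
    (auto simp: scaleR_fun_def fun_eq_iff scaleR_add_right scaleR_add_left)


section \<open>Smooth manifolds\<close>

primrec Ck_on :: "nat \<Rightarrow> 'a::euclidean_space set \<Rightarrow> ('a \<Rightarrow> 'b::real_normed_vector) \<Rightarrow> bool" where
  "Ck_on 0 S f \<longleftrightarrow> continuous_on S f"
| "Ck_on (Suc k) S f \<longleftrightarrow>
     f differentiable_on S \<and> (\<forall>b\<in>Basis. Ck_on k S (\<lambda>x. frechet_derivative f (at x) b))"

text \<open>Only meant for open \<open>S\<close>.\<close>

definition smooth_on :: "'a::euclidean_space set \<Rightarrow> ('a \<Rightarrow> 'b::real_normed_vector) \<Rightarrow> bool" where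
  "smooth_on S f \<longleftrightarrow> (\<forall>k. Ck_on k S f)"

text \<open>
  A chart is a pair of its domain and its coordinate map. The manifold is the whole type \<open>'q\<close>, of
  dimension \<open>CARD('n)\<close>; its Hausdorff and second countability axioms are the sort of \<open>'q\<close>.
\<close>

type_synonym ('q, 'n) atlas = "('q set \<times> ('q \<Rightarrow> real ^ 'n)) set"

definition smooth_atlas ::
  "('q::{t2_space,second_countable_topology}, 'n::finite) atlas \<Rightarrow> bool" where
  "smooth_atlas M \<longleftrightarrow>
     (\<Union>(U, \<phi>)\<in>M. U) = UNIV \<and>
     (\<forall>(U, \<phi>)\<in>M. open U \<and> open (\<phi> ` U) \<and> homeomorphism U (\<phi> ` U) \<phi> (inv_into U \<phi>)) \<and>
     (\<forall>(U, \<phi>)\<in>M. \<forall>(V, \<psi>)\<in>M. smooth_on (\<phi> ` (U \<inter> V)) (\<psi> \<circ> inv_into U \<phi>))"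

definition smooth_fun_on ::
  "('q::topological_space, 'n::finite) atlas \<Rightarrow> 'q set \<Rightarrow> ('q \<Rightarrow> real) \<Rightarrow> bool" where
  "smooth_fun_on M W f \<longleftrightarrow> (\<forall>(U, \<phi>)\<in>M. smooth_on (\<phi> ` (U \<inter> W)) (f \<circ> inv_into U \<phi>))"

definition smooth_fun_near ::
  "('q::topological_space, 'n::finite) atlas \<Rightarrow> 'q \<Rightarrow> ('q \<Rightarrow> real) \<Rightarrow> bool" where
  "smooth_fun_near M q f \<longleftrightarrow> (\<exists>W. open W \<and> q \<in> W \<and> smooth_fun_on M W f)"


section \<open>Tangent vectors, vector fields, distributions\<close>

text \<open>
  A tangent vector at \<open>q\<close> is a derivation of the algebra of germs at \<open>q\<close> of smooth functions. To
  have a unique functional per tangent vector, it is set to zero on functions that are not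
  smooth in any neighbourhood of \<open>q\<close>.
\<close>

type_synonym 'q tvec = "('q \<Rightarrow> real) \<Rightarrow> real"

definition tangent_space ::
  "('q::topological_space, 'n::finite) atlas \<Rightarrow> 'q \<Rightarrow> 'q tvec set" where
  "tangent_space M q = {v.
     (\<forall>f. \<not> smooth_fun_near M q f \<longrightarrow> v f = 0) \<and>
     (\<forall>f h. (\<forall>\<^sub>F p in nhds q. f p = h p) \<longrightarrow> v f = v h) \<and>
     (\<forall>f h. smooth_fun_near M q f \<longrightarrow> smooth_fun_near M q h \<longrightarrow>
        v (\<lambda>p. f p + h p) = v f + v h) \<and>
     (\<forall>c f. smooth_fun_near M q f \<longrightarrow> v (\<lambda>p. c * f p) = c * v f) \<and>
     (\<forall>f h. smooth_fun_near M q f \<longrightarrow> smooth_fun_near M q h \<longrightarrow>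
        v (\<lambda>p. f p * h p) = v f * h q + f q * v h)}"

definition smooth_vector_field_on ::
  "('q::topological_space, 'n::finite) atlas \<Rightarrow> 'q set \<Rightarrow> ('q \<Rightarrow> 'q tvec) \<Rightarrow> bool" where
  "smooth_vector_field_on M W Y \<longleftrightarrow>
     (\<forall>q\<in>W. Y q \<in> tangent_space M q) \<and>
     (\<forall>V f. open V \<longrightarrow> V \<subseteq> W \<longrightarrow> smooth_fun_on M V f \<longrightarrow> smooth_fun_on M V (\<lambda>q. Y q f))"

definition smooth_vector_field_near ::
  "('q::topological_space, 'n::finite) atlas \<Rightarrow> 'q \<Rightarrow> ('q \<Rightarrow> 'q tvec) \<Rightarrow> bool" where
  "smooth_vector_field_near M q Y \<longleftrightarrow> (\<exists>W. open W \<and> q \<in> W \<and> smooth_vector_field_on M W Y)"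

definition lie_bracket ::
  "('q::topological_space, 'n::finite) atlas \<Rightarrow> ('q \<Rightarrow> 'q tvec) \<Rightarrow> ('q \<Rightarrow> 'q tvec) \<Rightarrow> 'q \<Rightarrow> 'q tvec"
  where
  "lie_bracket M Y Z q = (\<lambda>f. if smooth_fun_near M q f
     then Y q (\<lambda>p. Z p f) - Z q (\<lambda>p. Y p f) else 0)"

definition smooth_distribution ::
  "('q::topological_space, 'n::finite) atlas \<Rightarrow> nat \<Rightarrow> ('q \<Rightarrow> 'q tvec set) \<Rightarrow> bool" where
  "smooth_distribution M m D \<longleftrightarrow>
     (\<forall>q. \<exists>W Y. open W \<and> q \<in> W \<and> (\<forall>j<m. smooth_vector_field_on M W (Y j)) \<and>
        (\<forall>p\<in>W. D p = span ((\<lambda>j::nat. Y j p) ` {..<m}) \<and> dim (D p) = m))"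


section \<open>Metrics and their modifications\<close>

type_synonym 'q tensor02 = "'q \<Rightarrow> 'q tvec \<Rightarrow> 'q tvec \<Rightarrow> real"

definition symmetric_tensor_field ::
  "('q::topological_space, 'n::finite) atlas \<Rightarrow> 'q tensor02 \<Rightarrow> bool" where
  "symmetric_tensor_field M g \<longleftrightarrow>
     (\<forall>q. \<forall>u\<in>tangent_space M q. \<forall>v\<in>tangent_space M q. \<forall>w\<in>tangent_space M q. \<forall>c.
        g q u v = g q v u \<and>
        g q (u + v) w = g q u w + g q v w \<and>
        g q (c *\<^sub>R u) w = c * g q u w) \<and>
     (\<forall>V Y Z. open V \<longrightarrow> smooth_vector_field_on M V Y \<longrightarrow> smooth_vector_field_on M V Z \<longrightarrow>
        smooth_fun_on M V (\<lambda>q. g q (Y q) (Z q)))"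

definition nondegenerate_on :: "'q tvec set \<Rightarrow> ('q tvec \<Rightarrow> 'q tvec \<Rightarrow> real) \<Rightarrow> bool" where
  "nondegenerate_on S b \<longleftrightarrow> (\<forall>v\<in>S. (\<forall>w\<in>S. b v w = 0) \<longrightarrow> v = 0)"

definition riemannian_metric ::
  "('q::topological_space, 'n::finite) atlas \<Rightarrow> 'q tensor02 \<Rightarrow> bool" where
  "riemannian_metric M g \<longleftrightarrow> symmetric_tensor_field M g \<and>
     (\<forall>q. \<forall>v\<in>tangent_space M q. v \<noteq> 0 \<longrightarrow> g q v v > 0)"

text \<open>The signature is locally constant by nondegeneracy.\<close>

definition pseudo_riemannian_metric ::
  "('q::topological_space, 'n::finite) atlas \<Rightarrow> 'q tensor02 \<Rightarrow> bool" where
  "pseudo_riemannian_metric M g \<longleftrightarrow> symmetric_tensor_field M g \<and>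
     (\<forall>q. nondegenerate_on (tangent_space M q) (g q))"

definition orthogonal_distribution ::
  "('q::topological_space, 'n::finite) atlas \<Rightarrow> 'q tensor02 \<Rightarrow> ('q \<Rightarrow> 'q tvec set) \<Rightarrow> 'q \<Rightarrow> 'q tvec set"
  where
  "orthogonal_distribution M g D q = {v \<in> tangent_space M q. \<forall>w\<in>D q. g q v w = 0}"

definition preserving_modification ::
  "('q::topological_space, 'n::finite) atlas \<Rightarrow> ('q \<Rightarrow> 'q tvec set) \<Rightarrow> 'q tensor02 \<Rightarrow> 'q tensor02 \<Rightarrow> bool"
  where
  "preserving_modification M D g gb \<longleftrightarrow> symmetric_tensor_field M gb \<and>
     (\<forall>q. \<forall>v\<in>D q. \<forall>w\<in>D q. gb q v w = g q v w)"

text \<open>The conformal factor and the preserving modification are recorded as arguments.\<close>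

definition conformal_modification ::
  "('q::topological_space, 'n::finite) atlas \<Rightarrow> ('q \<Rightarrow> 'q tvec set) \<Rightarrow> 'q tensor02 \<Rightarrow>
   ('q \<Rightarrow> real) \<Rightarrow> 'q tensor02 \<Rightarrow> 'q tensor02 \<Rightarrow> bool"
  where
  "conformal_modification M D g F gb gh \<longleftrightarrow>
     smooth_fun_on M UNIV F \<and> preserving_modification M D g gb \<and> symmetric_tensor_field M gh \<and>
     (\<forall>q. \<forall>v\<in>tangent_space M q. \<forall>w\<in>tangent_space M q. gh q v w = exp (2 * F q) * gb q v w)"


section \<open>Levi-Civita connections\<close>

text \<open>
  \<open>N q v Y\<close> is the covariant derivative at \<open>q\<close> along the tangent vector \<open>v\<close> of the vector field
  \<open>Y\<close>, which need only be defined and smooth near \<open>q\<close>. The base point is an argument because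
  the zero functional belongs to every tangent space.
\<close>

type_synonym 'q connection = "'q \<Rightarrow> 'q tvec \<Rightarrow> ('q \<Rightarrow> 'q tvec) \<Rightarrow> 'q tvec"

definition affine_connection ::
  "('q::topological_space, 'n::finite) atlas \<Rightarrow> 'q connection \<Rightarrow> bool" where
  "affine_connection M N \<longleftrightarrow>
     (\<forall>q. \<forall>u\<in>tangent_space M q. \<forall>v\<in>tangent_space M q. \<forall>c. \<forall>Y Z.
        smooth_vector_field_near M q Y \<longrightarrow> smooth_vector_field_near M q Z \<longrightarrow>
          N q v Y \<in> tangent_space M q \<and>
          N q (u + v) Y = N q u Y + N q v Y \<and>
          N q (c *\<^sub>R v) Y = c *\<^sub>R N q v Y \<and>
          N q v (\<lambda>p. Y p + Z p) = N q v Y + N q v Z \<and>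
          (\<forall>f. smooth_fun_near M q f \<longrightarrow>
             N q v (\<lambda>p. f p *\<^sub>R Y p) = v f *\<^sub>R Y q + f q *\<^sub>R N q v Y) \<and>
          ((\<forall>\<^sub>F p in nhds q. Y p = Z p) \<longrightarrow> N q v Y = N q v Z)) \<and>
     (\<forall>W Y Z. open W \<longrightarrow> smooth_vector_field_on M W Y \<longrightarrow> smooth_vector_field_on M W Z \<longrightarrow>
        smooth_vector_field_on M W (\<lambda>p. N p (Y p) Z))"

definition levi_civita_connection ::
  "('q::topological_space, 'n::finite) atlas \<Rightarrow> 'q tensor02 \<Rightarrow> 'q connection \<Rightarrow> bool" where
  "levi_civita_connection M g N \<longleftrightarrow> affine_connection M N \<and>
     (\<forall>q Y Z. smooth_vector_field_near M q Y \<longrightarrow> smooth_vector_field_near M q Z \<longrightarrow>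
        N q (Y q) Z - N q (Z q) Y = lie_bracket M Y Z q \<and>
        (\<forall>v\<in>tangent_space M q.
           v (\<lambda>p. g p (Y p) (Z p)) = g q (N q v Y) (Z q) + g q (Y q) (N q v Z)))"


section \<open>Adapted frames and components\<close>

text \<open>
  The type \<open>'n\<close> of coordinate indices is also the range of the Greek frame indices. A set
  \<open>A\<close> of them holds the indices \<open>a, b, \<dots>\<close> of the distribution and its complement holds the
  indices \<open>i, j, \<dots>\<close>, so that every rank from \<open>0\<close> to \<open>CARD('n)\<close> is covered.
\<close>

definition local_frame ::
  "('q::topological_space, 'n::finite) atlas \<Rightarrow> 'q set \<Rightarrow> ('n \<Rightarrow> 'q \<Rightarrow> 'q tvec) \<Rightarrow> bool" where
  "local_frame M U X \<longleftrightarrow> open U \<and> (\<forall>\<alpha>. smooth_vector_field_on M U (X \<alpha>)) \<and>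
     (\<forall>q\<in>U. inj (\<lambda>\<alpha>. X \<alpha> q) \<and> independent (range (\<lambda>\<alpha>. X \<alpha> q)) \<and>
        span (range (\<lambda>\<alpha>. X \<alpha> q)) = tangent_space M q)"

definition adapted_frame ::
  "('q::topological_space, 'n::finite) atlas \<Rightarrow> 'q tensor02 \<Rightarrow> ('q \<Rightarrow> 'q tvec set) \<Rightarrow>
   'q set \<Rightarrow> 'n set \<Rightarrow> ('n \<Rightarrow> 'q \<Rightarrow> 'q tvec) \<Rightarrow> bool"
  where
  "adapted_frame M g D U A X \<longleftrightarrow> local_frame M U X \<and>
     (\<forall>q\<in>U. span ((\<lambda>a. X a q) ` A) = D q \<and>
            span ((\<lambda>i. X i q) ` (- A)) = orthogonal_distribution M g D q)"

definition frame_component ::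
  "('n \<Rightarrow> 'q \<Rightarrow> 'q tvec) \<Rightarrow> 'q \<Rightarrow> 'q tvec \<Rightarrow> 'n \<Rightarrow> real" where
  "frame_component X q v \<gamma> = representation (range (\<lambda>\<alpha>. X \<alpha> q)) v (X \<gamma> q)"

definition christoffel ::
  "'q connection \<Rightarrow> ('n \<Rightarrow> 'q \<Rightarrow> 'q tvec) \<Rightarrow> 'q \<Rightarrow> 'n \<Rightarrow> 'n \<Rightarrow> 'n \<Rightarrow> real" where
  "christoffel N X q \<gamma> \<alpha> \<beta> = frame_component X q (N q (X \<alpha> q) (X \<beta>)) \<gamma>"

definition bracket_coeff ::
  "('q::topological_space, 'n::finite) atlas \<Rightarrow> ('n \<Rightarrow> 'q \<Rightarrow> 'q tvec) \<Rightarrow> 'q \<Rightarrow> 'n \<Rightarrow> 'n \<Rightarrow> 'n \<Rightarrow> real"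
  where
  "bracket_coeff M X q \<gamma> \<alpha> \<beta> = frame_component X q (lie_bracket M (X \<alpha>) (X \<beta>) q) \<gamma>"

definition metric_coeff ::
  "'q tensor02 \<Rightarrow> ('n \<Rightarrow> 'q \<Rightarrow> 'q tvec) \<Rightarrow> 'q \<Rightarrow> 'n \<Rightarrow> 'n \<Rightarrow> real" where
  "metric_coeff g X q \<alpha> \<beta> = g q (X \<alpha> q) (X \<beta> q)"

definition inverse_metric_coeff ::
  "'q tensor02 \<Rightarrow> ('n::finite \<Rightarrow> 'q \<Rightarrow> 'q tvec) \<Rightarrow> 'q \<Rightarrow> 'n \<Rightarrow> 'n \<Rightarrow> real" where
  "inverse_metric_coeff g X q \<alpha> \<beta> =
     matrix_inv (\<chi> \<alpha> \<beta>. metric_coeff g X q \<alpha> \<beta>) $ \<alpha> $ \<beta>"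

definition kronecker :: "'n \<Rightarrow> 'n \<Rightarrow> real" where
  "kronecker \<alpha> \<beta> = (if \<alpha> = \<beta> then 1 else 0)"


section \<open>The nonholonomic vector field\<close>

text \<open>
  Functions on the submanifold \<open>D\<close> of the tangent bundle, over the domain of an adapted frame, are
  written as functions of the base point \<open>q\<close> and of the quasi-velocities \<open>v\<close>, of which only the
  components in \<open>A\<close> are meaningful on \<open>D\<close>.

  \<open>nonholonomic_field\<close> is the derivation along the vector field on \<open>D\<close> whose integral curves satisfy
  \<open>q' = v\<^sup>a X\<^sub>a(q)\<close> and \<open>(v\<^sup>d)' = - \<Gamma>\<^sup>d\<^sub>a\<^sub>b v\<^sup>a v\<^sup>b\<close>, with \<open>\<Gamma>\<close> the Christoffel symbols of \<open>N\<close>.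
\<close>

definition nonholonomic_field ::
  "'q connection \<Rightarrow> ('n \<Rightarrow> 'q \<Rightarrow> 'q tvec) \<Rightarrow> 'n set \<Rightarrow>
   ('q \<Rightarrow> ('n \<Rightarrow> real) \<Rightarrow> real) \<Rightarrow> 'q \<Rightarrow> ('n \<Rightarrow> real) \<Rightarrow> real"
  where
  "nonholonomic_field N X A f q v =
     (\<Sum>a\<in>A. v a * X a q (\<lambda>p. f p v)) -
     (\<Sum>d\<in>A. (\<Sum>a\<in>A. \<Sum>b\<in>A. christoffel N X q d a b * v a * v b) *
        deriv (\<lambda>t. f q (v(d := t))) (v d))"

definition lagrange_multiplier ::
  "'q tensor02 \<Rightarrow> 'q connection \<Rightarrow> ('n::finite \<Rightarrow> 'q \<Rightarrow> 'q tvec) \<Rightarrow> 'n set \<Rightarrow>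
   'n \<Rightarrow> 'q \<Rightarrow> ('n \<Rightarrow> real) \<Rightarrow> real"
  where
  "lagrange_multiplier g N X A i q v =
     (\<Sum>k\<in>-A. \<Sum>a\<in>A. \<Sum>b\<in>A. metric_coeff g X q k i * christoffel N X q k a b * v a * v b)"

definition modification_momentum ::
  "'q tensor02 \<Rightarrow> ('n \<Rightarrow> 'q \<Rightarrow> 'q tvec) \<Rightarrow> 'n set \<Rightarrow> 'n \<Rightarrow> 'q \<Rightarrow> ('n \<Rightarrow> real) \<Rightarrow> real" where
  "modification_momentum gb X A i q v = (\<Sum>a\<in>A. metric_coeff gb X q a i * v a)"

end

theory Submission
  imports Defs
begin

text \<open>
  Let \<open>E\<close> be the tangent vector whose components are the differences of the two sides of the first
  two conditions. Since \<open>gb\<close> is nondegenerate, \<open>E\<close> vanishes iff \<open>gb(E, X\<^sub>\<beta>) = 0\<close> for all \<open>\<beta>\<close>.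
  The Koszul formulas of \<open>g\<close> and \<open>gb\<close>, evaluated on a vector of the distribution \<open>D\<close>, differ only
  in the terms containing \<open>gb\<^sub>a\<^sub>i\<close>, because \<open>gb = g\<close> on \<open>D\<close> and \<open>g\<^sub>a\<^sub>i = 0\<close>. Subtracting them turns
  \<open>gb(E, X\<^sub>c)\<close> into minus the left-hand side of (A') and \<open>gb(E, X\<^sub>i)\<close> into that of (B').
\<close>

section \<open>Linear combinations of smooth functions\<close>

text \<open>At a point of an open set \<open>frechet_derivative\<close> depends only on nearby
  values, so functions that agree on \<open>S\<close> also have equal derivatives there. This allows
  a derivative rule valid only on \<open>S\<close> to be substituted inside
  \<open>Ck_on\<close>.\<close>

lemma Ck_on_cong:
  assumes "open S" "\<And>x. x \<in> S \<Longrightarrow> f x = h x" "Ck_on k S f"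
  shows "Ck_on k S h"
  using assms(2,3)
proof (induction k arbitrary: f h)
  case 0
  then show ?case
    using continuous_on_eq by auto
next
  case (Suc k)
  have diff: "f differentiable at x" if "x \<in> S" for x
    using Suc.prems(2) that assms(1) by (simp add: differentiable_on_eq_differentiable_at)
  have der: "frechet_derivative f (at x) = frechet_derivative h (at x)" if "x \<in> S" for x
    using frechet_derivative_transform_within_open[OF diff[OF that] assms(1) that] Suc.prems(1)
    by blast
  have "h differentiable at x" if "x \<in> S" for x
    using has_derivative_transform_within_open[OF _ assms(1) that] diff[OF that] Suc.prems(1)
    unfolding differentiable_def by blast
  then have "h differentiable_on S"
    using assms(1) by (simp add: differentiable_on_eq_differentiable_at)
  moreover have "Ck_on k S (\<lambda>x. frechet_derivative h (at x) b)" if "b \<in> Basis" for b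
    using Suc.IH[of "\<lambda>x. frechet_derivative f (at x) b"] der Suc.prems(2) that by simp
  ultimately show ?case
    by simp
qed

lemma Ck_on_zero: "Ck_on k S (\<lambda>_. 0)"
  by (induction k) simp_all

text \<open>Sums and scalar multiples are treated together. The induction lets both functions vary
  because its hypothesis is applied to their partial derivatives.\<close>

lemma Ck_on_add_scaleR:
  assumes "open S" "Ck_on k S f" "Ck_on k S h"
  shows "Ck_on k S (\<lambda>x. f x + c *\<^sub>R h x)"
  using assms(2,3)
proof (induction k arbitrary: f h)
  case 0
  then show ?case
    by (auto intro!: continuous_intros)
next
  case (Suc k)
  have diff: "f differentiable at x" "h differentiable at x" if "x \<in> S" for x
    using Suc.prems that assms(1) by (simp_all add: differentiable_on_eq_differentiable_at)
  have der: "frechet_derivative (\<lambda>x. f x + c *\<^sub>R h x) (at x) =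
      (\<lambda>b. frechet_derivative f (at x) b + c *\<^sub>R frechet_derivative h (at x) b)"
    if "x \<in> S" for x
    using diff[OF that] unfolding frechet_derivative_works
    by (intro frechet_derivative_at[symmetric] derivative_intros)
  have "(\<lambda>x. f x + c *\<^sub>R h x) differentiable_on S"
    using diff assms(1) by (simp add: differentiable_on_eq_differentiable_at)
  moreover have "Ck_on k S (\<lambda>x. frechet_derivative (\<lambda>x. f x + c *\<^sub>R h x) (at x) b)"
    if "b \<in> Basis" for b
  proof (rule Ck_on_cong[OF assms(1)])
    show "Ck_on k S (\<lambda>x. frechet_derivative f (at x) b + c *\<^sub>R frechet_derivative h (at x) b)"
      using Suc.IH Suc.prems that by simp
  qed (simp add: der)
  ultimately show ?case
    by simp
qed

text \<open>A chart is a homeomorphism onto an open set. This supplies the openness on which the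
  rules for \<open>Ck_on\<close> depend.\<close>

lemma smooth_atlas_open_image:
  assumes "smooth_atlas M" "(V, \<phi>) \<in> M" "open W"
  shows "open (\<phi> ` (V \<inter> W))"
proof -
  have "homeomorphism V (\<phi> ` V) \<phi> (inv_into V \<phi>)" "open (\<phi> ` V)"
    using assms(1,2) unfolding smooth_atlas_def by fast+
  then show ?thesis
    using homeomorphism_imp_open_map assms(3) openin_open_trans by blast
qed

lemma smooth_fun_on_zero: "smooth_fun_on M W (\<lambda>_. 0)"
  by (auto simp: smooth_fun_on_def smooth_on_def comp_def Ck_on_zero)

lemma smooth_fun_on_add_mult:
  assumes "smooth_atlas M" "open W" "smooth_fun_on M W f" "smooth_fun_on M W h"
  shows "smooth_fun_on M W (\<lambda>p. f p + c * h p)"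
  unfolding smooth_fun_on_def smooth_on_def
proof clarify
  fix V \<phi> k
  assume chart: "(V, \<phi>) \<in> M"
  let ?S = "\<phi> ` (V \<inter> W)" and ?\<psi> = "inv_into V \<phi>"
  have "Ck_on k ?S (f \<circ> ?\<psi>)" "Ck_on k ?S (h \<circ> ?\<psi>)"
    using assms(3,4) chart unfolding smooth_fun_on_def smooth_on_def by auto
  from Ck_on_add_scaleR[OF smooth_atlas_open_image[OF assms(1) chart assms(2)] this, of c]
  show "Ck_on k ?S ((\<lambda>p. f p + c * h p) \<circ> ?\<psi>)"
    by (simp add: comp_def)
qed

lemma smooth_fun_on_sum:
  assumes "smooth_atlas M" "open W" "finite B" "\<And>b. b \<in> B \<Longrightarrow> smooth_fun_on M W (f b)"
  shows "smooth_fun_on M W (\<lambda>p. \<Sum>b\<in>B. c b * f b p)"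
  using assms(3,4)
proof (induction B)
  case empty
  then show ?case
    by (simp add: smooth_fun_on_zero)
next
  case (insert b B)
  then show ?case
    using smooth_fun_on_add_mult[OF assms(1,2), of "\<lambda>p. \<Sum>b\<in>B. c b * f b p" "f b" "c b"]
    by (simp add: add.commute)
qed

text \<open>A tangent vector acts on germs. Identities between metric coefficients that hold
  throughout a frame domain thereby pass to their derivatives.\<close>

lemma tangent_space_cong:
  assumes "u \<in> tangent_space M q" "open W" "q \<in> W" "\<And>p. p \<in> W \<Longrightarrow> f p = h p"
  shows "u f = u h"
proof -
  have "\<forall>\<^sub>F p in nhds q. f p = h p"
    using assms(2-4) eventually_nhds by blast
  then show ?thesis
    using assms(1) by (simp add: tangent_space_def)
qed

lemma tangent_space_zero_fun:
  assumes "u \<in> tangent_space M q"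
  shows "u (\<lambda>_. 0) = 0"
proof -
  have "smooth_fun_near M q (\<lambda>_. 0)"
    using smooth_fun_on_zero unfolding smooth_fun_near_def by blast
  \<comment> \<open>Homogeneity with factor 0, applied to the zero function.\<close>
  then have "u (\<lambda>p. 0 * 0) = 0 * u (\<lambda>_. 0)"
    using assms unfolding tangent_space_def by blast
  then show ?thesis
    by simp
qed

text \<open>The derivation laws cover only functions smooth near \<open>q\<close>, so smoothness on
  a common neighbourhood accompanies every partial sum. The lemma serves to differentiate momenta
  while the velocities are held constant.\<close>

lemma tangent_space_sum_fun:
  assumes "smooth_atlas M" "u \<in> tangent_space M q" "open W" "q \<in> W" "finite B"
    and "\<And>b. b \<in> B \<Longrightarrow> smooth_fun_on M W (f b)"
  shows "u (\<lambda>p. \<Sum>b\<in>B. c b * f b p) = (\<Sum>b\<in>B. c b * u (f b))"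
  using assms(5,6)
proof (induction B)
  case empty
  then show ?case
    using tangent_space_zero_fun[OF assms(2)] by simp
next
  case (insert b B)
  have near: "smooth_fun_near M q h" if "smooth_fun_on M W h" for h
    using that assms(3,4) unfolding smooth_fun_near_def by blast
  have b: "smooth_fun_on M W (f b)"
    using insert.prems by simp
  have "smooth_fun_near M q (\<lambda>p. c b * f b p)"
    using smooth_fun_on_add_mult[OF assms(1,3) smooth_fun_on_zero b, of "c b"] by (simp add: near)
  moreover have "smooth_fun_near M q (\<lambda>p. \<Sum>b\<in>B. c b * f b p)"
    using insert.prems by (intro near smooth_fun_on_sum assms(1,3) insert.hyps(1)) simp
  ultimately have "u (\<lambda>p. c b * f b p + (\<Sum>b\<in>B. c b * f b p)) =
      u (\<lambda>p. c b * f b p) + u (\<lambda>p. \<Sum>b\<in>B. c b * f b p)"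
    using assms(2) unfolding tangent_space_def by blast
  moreover have "u (\<lambda>p. c b * f b p) = c b * u (f b)"
    using assms(2) near[OF b] unfolding tangent_space_def by blast
  ultimately show ?case
    using insert by simp
qed


section \<open>Components in a local frame\<close>

lemma local_frame_in_tangent_space:
  assumes "local_frame M U X" "q \<in> U"
  shows "X \<alpha> q \<in> tangent_space M q"
  using assms unfolding local_frame_def by (metis rangeI span_base)

lemma local_frame_vector_field_near:
  assumes "local_frame M U X" "q \<in> U"
  shows "smooth_vector_field_near M q (X \<alpha>)"
  using assms unfolding local_frame_def smooth_vector_field_near_def by blast

lemma subspace_tangent_space:
  assumes "local_frame M U X" "q \<in> U"
  shows "subspace (tangent_space M q)"
  using assms unfolding local_frame_def by (metis subspace_span)

text \<open>\<open>representation\<close> is indexed by basis vectors; injectivity of the frame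
  converts this into indexing by frame indices.\<close>

lemma frame_expansion:
  fixes X :: "'n::finite \<Rightarrow> 'q::topological_space \<Rightarrow> 'q tvec"
  assumes "local_frame M U X" "q \<in> U" "u \<in> tangent_space M q"
  shows "(\<Sum>\<gamma>\<in>UNIV. frame_component X q u \<gamma> *\<^sub>R X \<gamma> q) = u"
proof -
  let ?B = "range (\<lambda>\<alpha>. X \<alpha> q)"
  have frame: "inj (\<lambda>\<alpha>. X \<alpha> q)" "independent ?B" "u \<in> span ?B"
    using assms unfolding local_frame_def by auto
  have "(\<Sum>b\<in>?B. representation ?B u b *\<^sub>R b) = u"
    using frame by (intro real_vector.sum_representation_eq) auto
  then show ?thesis
    using frame(1) by (simp add: sum.reindex frame_component_def)
qed

lemma frame_component_uminus:
  assumes "local_frame M U X" "q \<in> U" "u \<in> tangent_space M q"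
  shows "frame_component X q (- u) \<gamma> = - frame_component X q u \<gamma>"
  using assms unfolding local_frame_def frame_component_def
  by (simp add: real_vector.representation_neg)

lemma frame_sum_zero:
  fixes X :: "'n::finite \<Rightarrow> 'q::topological_space \<Rightarrow> 'q tvec"
  assumes "local_frame M U X" "q \<in> U" "(\<Sum>\<gamma>\<in>UNIV. c \<gamma> *\<^sub>R X \<gamma> q) = 0"
  shows "c \<gamma> = 0"
proof -
  let ?B = "range (\<lambda>\<alpha>. X \<alpha> q)" and ?Xq = "\<lambda>\<alpha>. X \<alpha> q"
  have frame: "inj ?Xq" "independent ?B"
    using assms unfolding local_frame_def by auto
  have inv: "inv ?Xq (X \<alpha> q) = \<alpha>" for \<alpha>
    using inv_f_f[OF frame(1)] .
  \<comment> \<open>Independence speaks of coefficients attached to vectors, so \<open>c\<close> is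
    transported along the inverse of \<open>?Xq\<close>.\<close>
  have "(\<Sum>b\<in>?B. c (inv ?Xq b) *\<^sub>R b) = 0"
    unfolding sum.reindex[OF frame(1)] comp_def inv by (rule assms(3))
  then have "c (inv ?Xq (X \<gamma> q)) = 0"
    by (intro independentD[OF frame(2), of ?B "\<lambda>b. c (inv ?Xq b)"]) auto
  then show ?thesis
    unfolding inv .
qed

lemma sum_kronecker:
  assumes "finite B" "a \<in> B"
  shows "(\<Sum>b\<in>B. f b * kronecker a b) = f a" "(\<Sum>b\<in>B. f b * kronecker b a) = f a"
proof -
  have "(\<Sum>b\<in>B. f b * kronecker a b) = (\<Sum>b\<in>B. if a = b then f b else 0)"
    "(\<Sum>b\<in>B. f b * kronecker b a) = (\<Sum>b\<in>B. if b = a then f b else 0)"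
    by (intro sum.cong refl, simp add: kronecker_def)+
  then show "(\<Sum>b\<in>B. f b * kronecker a b) = f a" "(\<Sum>b\<in>B. f b * kronecker b a) = f a"
    using assms by simp_all
qed


section \<open>Metrics and connections in a local frame\<close>

lemma symmetric_tensor_field_commute:
  assumes "symmetric_tensor_field M g" "u \<in> tangent_space M q" "w \<in> tangent_space M q"
  shows "g q u w = g q w u"
  using assms unfolding symmetric_tensor_field_def by blast

lemma symmetric_tensor_field_add:
  assumes "symmetric_tensor_field M g" "u \<in> tangent_space M q" "v \<in> tangent_space M q"
    "w \<in> tangent_space M q"
  shows "g q (u + v) w = g q u w + g q v w"
  using assms unfolding symmetric_tensor_field_def by blast

lemma symmetric_tensor_field_scaleR:
  assumes "symmetric_tensor_field M g" "u \<in> tangent_space M q" "w \<in> tangent_space M q"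
  shows "g q (c *\<^sub>R u) w = c * g q u w"
  using assms unfolding symmetric_tensor_field_def by blast

text \<open>Linearity is available on tangent vectors only; the \<open>subspace\<close> hypothesis
  keeps every partial sum among them.\<close>

lemma symmetric_tensor_field_sum:
  assumes "symmetric_tensor_field M g" "subspace (tangent_space M q)" "finite B"
    and "\<And>b. b \<in> B \<Longrightarrow> u b \<in> tangent_space M q" "w \<in> tangent_space M q"
  shows "g q (\<Sum>b\<in>B. c b *\<^sub>R u b) w = (\<Sum>b\<in>B. c b * g q (u b) w)"
  using assms(3,4)
proof (induction B)
  case empty
  have "g q (0 *\<^sub>R 0) w = 0 * g q 0 w"
    by (intro symmetric_tensor_field_scaleR[OF assms(1)] subspace_0 assms)
  then have "g q 0 w = 0"
    unfolding scaleR_zero_left by simp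
  then show ?case
    unfolding sum.empty .
next
  case (insert b B)
  have terms: "c b *\<^sub>R u b \<in> tangent_space M q" "(\<Sum>b\<in>B. c b *\<^sub>R u b) \<in> tangent_space M q"
    using insert.prems assms(2) by (auto intro!: subspace_scale subspace_sum)
  have "g q (c b *\<^sub>R u b) w = c b * g q (u b) w"
    by (rule symmetric_tensor_field_scaleR[OF assms(1) insert.prems assms(5)]) simp
  then show ?case
    unfolding sum.insert[OF insert.hyps] symmetric_tensor_field_add[OF assms(1) terms assms(5)]
    using insert.IH insert.prems by simp
qed

lemma metric_expand_left:
  fixes X :: "'n::finite \<Rightarrow> 'q::topological_space \<Rightarrow> 'q tvec"
  assumes "symmetric_tensor_field M g" "local_frame M U X" "q \<in> U" "u \<in> tangent_space M q"
  shows "g q u (X \<delta> q) = (\<Sum>\<gamma>\<in>UNIV. frame_component X q u \<gamma> * metric_coeff g X q \<gamma> \<delta>)"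
  using symmetric_tensor_field_sum[OF assms(1) subspace_tangent_space[OF assms(2,3)],
      of UNIV "\<lambda>\<gamma>. X \<gamma> q" "X \<delta> q" "frame_component X q u"]
  by (simp add: frame_expansion[OF assms(2-4)] local_frame_in_tangent_space[OF assms(2,3)]
      metric_coeff_def)

lemma metric_coeff_commute:
  assumes "symmetric_tensor_field M g" "local_frame M U X" "q \<in> U"
  shows "metric_coeff g X q \<alpha> \<beta> = metric_coeff g X q \<beta> \<alpha>"
  using symmetric_tensor_field_commute[OF assms(1)] local_frame_in_tangent_space[OF assms(2,3)]
  unfolding metric_coeff_def by blast

lemma smooth_metric_coeff:
  assumes "symmetric_tensor_field M g" "local_frame M U X"
  shows "smooth_fun_on M U (\<lambda>p. metric_coeff g X p \<alpha> \<beta>)"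
  using assms unfolding symmetric_tensor_field_def local_frame_def metric_coeff_def by blast

text \<open>A kernel vector of \<open>G\<close> holds the components of a tangent vector orthogonal
  to the whole frame, hence to the tangent space. Nondegeneracy makes that vector zero, and
  independence of the frame then makes its components zero.\<close>

lemma matrix_inv_metric_coeff:
  fixes X :: "'n::finite \<Rightarrow> 'q::topological_space \<Rightarrow> 'q tvec"
  assumes "symmetric_tensor_field M g" "nondegenerate_on (tangent_space M q) (g q)"
    and "local_frame M U X" "q \<in> U"
  defines "G \<equiv> \<chi> \<alpha> \<beta>. metric_coeff g X q \<alpha> \<beta>"
  shows "matrix_inv G ** G = mat 1" "G ** matrix_inv G = mat 1"
proof -
  have tangent: "X \<alpha> q \<in> tangent_space M q" for \<alpha>
    by (rule local_frame_in_tangent_space[OF assms(3,4)])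
  note subspace = subspace_tangent_space[OF assms(3,4)]
  have "x = 0" if ker: "G *v x = 0" for x
  proof -
    let ?u = "\<Sum>\<gamma>\<in>UNIV. (x $ \<gamma>) *\<^sub>R X \<gamma> q"
    have u: "?u \<in> tangent_space M q"
      using tangent subspace by (auto intro!: subspace_scale subspace_sum)
    have ortho: "g q (X \<delta> q) ?u = 0" for \<delta>
    proof -
      have "g q (X \<delta> q) ?u = g q ?u (X \<delta> q)"
        by (rule symmetric_tensor_field_commute[OF assms(1) tangent u])
      also have "\<dots> = (\<Sum>\<gamma>\<in>UNIV. x $ \<gamma> * metric_coeff g X q \<gamma> \<delta>)"
        unfolding metric_coeff_def
        by (rule symmetric_tensor_field_sum[OF assms(1) subspace]) (auto simp: tangent)
      also have "\<dots> = (G *v x) $ \<delta>"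
        by (simp add: G_def matrix_vector_mult_def metric_coeff_commute[OF assms(1,3,4), of \<delta>]
            mult.commute)
      finally show ?thesis
        using ker by simp
    qed
    have "g q ?u w = 0" if w: "w \<in> tangent_space M q" for w
    proof -
      have "g q (\<Sum>\<gamma>\<in>UNIV. frame_component X q w \<gamma> *\<^sub>R X \<gamma> q) ?u =
          (\<Sum>\<gamma>\<in>UNIV. frame_component X q w \<gamma> * g q (X \<gamma> q) ?u)"
        by (rule symmetric_tensor_field_sum[OF assms(1) subspace]) (auto simp: tangent u)
      then show ?thesis
        using symmetric_tensor_field_commute[OF assms(1) u w]
        by (simp add: frame_expansion[OF assms(3,4) w] ortho)
    qed
    then have "?u = 0"
      using assms(2) u unfolding nondegenerate_on_def by blast
    then show ?thesis
      using frame_sum_zero[OF assms(3,4), of "($) x"] by (simp add: vec_eq_iff)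
  qed
  then have "invertible G"
    by (auto simp: invertible_left_inverse matrix_left_invertible_ker)
  \<comment> \<open>\<open>matrix_inv\<close> is a choice, so its laws follow only once an inverse
    exists.\<close>
  then have "G ** matrix_inv G = mat 1 \<and> matrix_inv G ** G = mat 1"
    unfolding invertible_def matrix_inv_def by (rule someI_ex)
  then show "matrix_inv G ** G = mat 1" "G ** matrix_inv G = mat 1"
    by auto
qed

section \<open>Levi-Civita connections and the Koszul formula\<close>

lemma connection_in_tangent_space:
  assumes "levi_civita_connection M g N" "smooth_vector_field_near M q Y" "u \<in> tangent_space M q"
  shows "N q u Y \<in> tangent_space M q"
  using assms unfolding levi_civita_connection_def affine_connection_def by blast

lemma lie_bracket_eq_connection:
  assumes "levi_civita_connection M g N" "smooth_vector_field_near M q Y"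
    "smooth_vector_field_near M q Z"
  shows "lie_bracket M Y Z q = N q (Y q) Z - N q (Z q) Y"
  using assms unfolding levi_civita_connection_def by metis

text \<open>Torsion-freeness writes the bracket as a difference of covariant derivatives, which
  replaces a direct check that it is a derivation.\<close>

lemma lie_bracket_in_tangent_space:
  assumes "levi_civita_connection M g N" "local_frame M U X" "q \<in> U"
  shows "lie_bracket M (X \<alpha>) (X \<beta>) q \<in> tangent_space M q"
  using connection_in_tangent_space[OF assms(1)] local_frame_vector_field_near[OF assms(2,3)]
    local_frame_in_tangent_space[OF assms(2,3)] subspace_tangent_space[OF assms(2,3)]
  by (simp add: lie_bracket_eq_connection[OF assms(1)] subspace_diff)

text \<open>Needed to match the lower indices \<open>i a\<close> of the bracket coefficients in (B')
  with the order \<open>a i\<close> produced by the Koszul formula.\<close>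

lemma bracket_coeff_antisym:
  assumes "levi_civita_connection M g N" "local_frame M U X" "q \<in> U"
  shows "bracket_coeff M X q \<gamma> \<alpha> \<beta> = - bracket_coeff M X q \<gamma> \<beta> \<alpha>"
proof -
  have "lie_bracket M (X \<alpha>) (X \<beta>) q = - lie_bracket M (X \<beta>) (X \<alpha>) q"
    by (auto simp: lie_bracket_def)
  then show ?thesis
    using frame_component_uminus[OF assms(2,3) lie_bracket_in_tangent_space[OF assms]]
    by (simp add: bracket_coeff_def)
qed

text \<open>Metric compatibility moves the derivative to the other factor, and torsion-freeness then
  exchanges \<open>\<alpha>\<close> and \<open>\<delta>\<close> there. The remaining covariant
  derivative becomes a derivative of the metric only after symmetrization in \<open>\<alpha>\<close>
  and \<open>\<beta>\<close>.\<close>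

lemma christoffel_lower:
  fixes X :: "'n::finite \<Rightarrow> 'q::topological_space \<Rightarrow> 'q tvec"
  assumes "symmetric_tensor_field M g" "levi_civita_connection M g N" "local_frame M U X" "q \<in> U"
  shows "(\<Sum>\<gamma>\<in>UNIV. christoffel N X q \<gamma> \<alpha> \<beta> * metric_coeff g X q \<gamma> \<delta>) =
    X \<alpha> q (\<lambda>p. metric_coeff g X p \<beta> \<delta>)
    - (\<Sum>\<gamma>\<in>UNIV. bracket_coeff M X q \<gamma> \<alpha> \<delta> * metric_coeff g X q \<beta> \<gamma>)
    - g q (X \<beta> q) (N q (X \<delta> q) (X \<alpha>))"
proof -
  have tangent: "X \<alpha> q \<in> tangent_space M q" for \<alpha>
    by (rule local_frame_in_tangent_space[OF assms(3,4)])
  have near: "smooth_vector_field_near M q (X \<alpha>)" for \<alpha>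
    by (rule local_frame_vector_field_near[OF assms(3,4)])
  have conn: "N q (X \<alpha> q) (X \<beta>) \<in> tangent_space M q" for \<alpha> \<beta>
    by (rule connection_in_tangent_space[OF assms(2) near tangent])
  have bracket: "lie_bracket M (X \<alpha>) (X \<delta>) q \<in> tangent_space M q"
    by (rule lie_bracket_in_tangent_space[OF assms(2-4)])
  have "N q (X \<alpha> q) (X \<delta>) = lie_bracket M (X \<alpha>) (X \<delta>) q + N q (X \<delta> q) (X \<alpha>)"
    using lie_bracket_eq_connection[OF assms(2) near near, of \<alpha> \<delta>] by simp
  then have torsion: "g q (X \<beta> q) (N q (X \<alpha> q) (X \<delta>)) =
      g q (X \<beta> q) (lie_bracket M (X \<alpha>) (X \<delta>) q) + g q (X \<beta> q) (N q (X \<delta> q) (X \<alpha>))"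
    using symmetric_tensor_field_add[OF assms(1) bracket conn tangent, of \<delta> \<alpha> \<beta>]
      subspace_add[OF subspace_tangent_space[OF assms(3,4)] bracket conn, of \<delta> \<alpha>]
    by (simp only: symmetric_tensor_field_commute[OF assms(1) tangent] bracket conn)
  have "X \<alpha> q (\<lambda>p. metric_coeff g X p \<beta> \<delta>) =
      g q (N q (X \<alpha> q) (X \<beta>)) (X \<delta> q) + g q (X \<beta> q) (N q (X \<alpha> q) (X \<delta>))"
    using assms(2) near tangent unfolding levi_civita_connection_def metric_coeff_def by blast
  moreover have "(\<Sum>\<gamma>\<in>UNIV. christoffel N X q \<gamma> \<alpha> \<beta> * metric_coeff g X q \<gamma> \<delta>) =
      g q (N q (X \<alpha> q) (X \<beta>)) (X \<delta> q)"
    by (simp add: metric_expand_left[OF assms(1,3,4) conn] christoffel_def)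
  moreover have "(\<Sum>\<gamma>\<in>UNIV. bracket_coeff M X q \<gamma> \<alpha> \<delta> * metric_coeff g X q \<beta> \<gamma>) =
      g q (X \<beta> q) (lie_bracket M (X \<alpha>) (X \<delta>) q)"
    by (simp add: symmetric_tensor_field_commute[OF assms(1) tangent bracket]
        metric_expand_left[OF assms(1,3,4) bracket] bracket_coeff_def
        metric_coeff_commute[OF assms(1,3,4), of \<beta>])
  ultimately show ?thesis
    using torsion by linarith
qed

text \<open>Metric compatibility with both covariant derivatives in the second slot, the shape of
  the term left over in \<open>christoffel_lower\<close>.\<close>

lemma metric_coeff_derivative:
  fixes X :: "'n::finite \<Rightarrow> 'q::topological_space \<Rightarrow> 'q tvec"
  assumes "symmetric_tensor_field M g" "levi_civita_connection M g N" "local_frame M U X" "q \<in> U"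
  shows "X \<delta> q (\<lambda>p. metric_coeff g X p \<alpha> \<beta>) =
    g q (X \<beta> q) (N q (X \<delta> q) (X \<alpha>)) + g q (X \<alpha> q) (N q (X \<delta> q) (X \<beta>))"
proof -
  have tangent: "X \<alpha> q \<in> tangent_space M q" for \<alpha>
    by (rule local_frame_in_tangent_space[OF assms(3,4)])
  have near: "smooth_vector_field_near M q (X \<alpha>)" for \<alpha>
    by (rule local_frame_vector_field_near[OF assms(3,4)])
  have "X \<delta> q (\<lambda>p. metric_coeff g X p \<alpha> \<beta>) =
      g q (N q (X \<delta> q) (X \<alpha>)) (X \<beta> q) + g q (X \<alpha> q) (N q (X \<delta> q) (X \<beta>))"
    using assms(2) near tangent unfolding levi_civita_connection_def metric_coeff_def by blast
  then show ?thesis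
    using symmetric_tensor_field_commute[OF assms(1) tangent]
      connection_in_tangent_space[OF assms(2) near tangent] by metis
qed

text \<open>The Koszul formula for \<open>\<nabla>\<^sub>V V\<close>, where \<open>V = v\<^sup>a X\<^sub>a\<close> has constant components.\<close>

lemma koszul_quadratic:
  fixes X :: "'n::finite \<Rightarrow> 'q::topological_space \<Rightarrow> 'q tvec"
  assumes "symmetric_tensor_field M g" "levi_civita_connection M g N" "local_frame M U X" "q \<in> U"
  shows "(\<Sum>\<gamma>\<in>UNIV. (\<Sum>a\<in>A. \<Sum>b\<in>A. christoffel N X q \<gamma> a b * v a * v b) *
      metric_coeff g X q \<gamma> \<delta>) =
    (\<Sum>a\<in>A. \<Sum>b\<in>A. v a * v b * X a q (\<lambda>p. metric_coeff g X p b \<delta>))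
    - (\<Sum>\<gamma>\<in>UNIV. \<Sum>a\<in>A. modification_momentum g X A \<gamma> q v * bracket_coeff M X q \<gamma> a \<delta> * v a)
    - (\<Sum>a\<in>A. \<Sum>b\<in>A. v a * v b * X \<delta> q (\<lambda>p. metric_coeff g X p a b)) / 2"
proof -
  let ?n = "\<lambda>a b. g q (X b q) (N q (X \<delta> q) (X a))"
  have swap: "(\<Sum>a\<in>A. \<Sum>b\<in>A. v a * v b * ?n b a) = (\<Sum>a\<in>A. \<Sum>b\<in>A. v a * v b * ?n a b)"
    by (subst sum.swap) (simp add: mult.commute)
  \<comment> \<open>The weights \<open>v a * v b\<close> are symmetric, so the two terms of the
    metric derivative contribute equally; this is the origin of the factor one half.\<close>
  have half: "(\<Sum>a\<in>A. \<Sum>b\<in>A. v a * v b * X \<delta> q (\<lambda>p. metric_coeff g X p a b)) / 2 =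
      (\<Sum>a\<in>A. \<Sum>b\<in>A. v a * v b * ?n a b)"
    by (simp add: metric_coeff_derivative[OF assms] distrib_left sum.distrib swap)
  have "(\<Sum>\<gamma>\<in>UNIV. (\<Sum>a\<in>A. \<Sum>b\<in>A. christoffel N X q \<gamma> a b * v a * v b) *
      metric_coeff g X q \<gamma> \<delta>) =
      (\<Sum>a\<in>A. \<Sum>b\<in>A. v a * v b *
        (\<Sum>\<gamma>\<in>UNIV. christoffel N X q \<gamma> a b * metric_coeff g X q \<gamma> \<delta>))"
    by (simp add: sum_distrib_left sum_distrib_right sum.swap[of _ UNIV A] mult_ac)
  also have "\<dots> = (\<Sum>a\<in>A. \<Sum>b\<in>A. v a * v b * X a q (\<lambda>p. metric_coeff g X p b \<delta>))
      - (\<Sum>a\<in>A. \<Sum>b\<in>A. v a * v b *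
          (\<Sum>\<gamma>\<in>UNIV. bracket_coeff M X q \<gamma> a \<delta> * metric_coeff g X q b \<gamma>))
      - (\<Sum>a\<in>A. \<Sum>b\<in>A. v a * v b * ?n a b)"
    by (simp add: christoffel_lower[OF assms] right_diff_distrib sum_subtractf)
  \<comment> \<open>Summing over \<open>b\<close> first collects the momentum of \<open>g\<close>,
    here with a Greek index \<open>\<gamma>\<close>.\<close>
  also have "(\<Sum>a\<in>A. \<Sum>b\<in>A. v a * v b *
        (\<Sum>\<gamma>\<in>UNIV. bracket_coeff M X q \<gamma> a \<delta> * metric_coeff g X q b \<gamma>)) =
      (\<Sum>\<gamma>\<in>UNIV. \<Sum>a\<in>A. modification_momentum g X A \<gamma> q v * bracket_coeff M X q \<gamma> a \<delta> * v a)"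
    by (simp add: modification_momentum_def sum_distrib_left sum_distrib_right
        sum.swap[of _ UNIV A] mult_ac)
  finally show ?thesis
    by (simp only: half)
qed


section \<open>Equivalence of the two systems of conditions\<close>

theorem lemma1:
  fixes M :: "('q::{t2_space,second_countable_topology}, 'n::finite) atlas"
    and g gb gh :: "'q tensor02"
    and D :: "'q \<Rightarrow> 'q tvec set"
    and m :: nat
    and F :: "'q \<Rightarrow> real"
    and N Nb :: "'q connection"
    and U :: "'q set"
    and A :: "'n set"
    and X :: "'n \<Rightarrow> 'q \<Rightarrow> 'q tvec"
  assumes manifold: "smooth_atlas M"
    and metric: "riemannian_metric M g"
    and distribution: "smooth_distribution M m D"
    and modification: "conformal_modification M D g F gb gh"
    and pseudo_metric: "pseudo_riemannian_metric M gh"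
    and nondegenerate: "\<And>q. nondegenerate_on (orthogonal_distribution M gb D q) (gb q)"
    and connection: "levi_civita_connection M g N"
    and connection_bar: "levi_civita_connection M gb Nb"
    and rank: "card A = m"
    and frame: "adapted_frame M g D U A X"
  shows
    "(\<forall>q\<in>U. \<forall>v :: 'n \<Rightarrow> real.
        (\<forall>a\<in>A.
           (\<Sum>b\<in>A. \<Sum>c\<in>A. christoffel N X q a b c * v b * v c) =
           (\<Sum>b\<in>A. \<Sum>c\<in>A. christoffel Nb X q a b c * v b * v c)
           + (\<Sum>c\<in>A. X c q F * v c * v a)
           - (\<Sum>b\<in>A. \<Sum>c\<in>A. \<Sum>\<alpha>\<in>UNIV.
                metric_coeff g X q b c * inverse_metric_coeff gb X q \<alpha> a * X \<alpha> q F * v b * v c)) \<and>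
        (\<forall>i\<in>-A.
           0 = (\<Sum>b\<in>A. \<Sum>c\<in>A. christoffel Nb X q i b c * v b * v c)
             - (\<Sum>b\<in>A. \<Sum>c\<in>A. \<Sum>\<alpha>\<in>UNIV.
                  metric_coeff g X q b c * inverse_metric_coeff gb X q \<alpha> i * X \<alpha> q F * v b * v c)))
     \<longleftrightarrow>
     (\<forall>q\<in>U. \<forall>v :: 'n \<Rightarrow> real.
        (\<forall>c\<in>A.
           (\<Sum>a\<in>A. \<Sum>b\<in>A. \<Sum>d\<in>A. metric_coeff g X q b d *
              (kronecker a d * X c q F - kronecker c d * X a q F) * v a * v b)
           + (\<Sum>k\<in>-A. \<Sum>a\<in>A.
                modification_momentum gb X A k q v * bracket_coeff M X q k a c * v a) = 0) \<and>
        (\<forall>i\<in>-A.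
           nonholonomic_field N X A (modification_momentum gb X A i) q v
           + lagrange_multiplier g N X A i q v
           + (\<Sum>k\<in>-A. \<Sum>a\<in>A. modification_momentum gb X A k q v *
                (bracket_coeff M X q k i a + kronecker k i * X a q F) * v a)
           - (\<Sum>a\<in>A. \<Sum>b\<in>A. metric_coeff g X q a b * X i q F * v a * v b) = 0))"
proof -
  have g: "symmetric_tensor_field M g" and gb: "symmetric_tensor_field M gb"
    and gh: "\<And>q u w. u \<in> tangent_space M q \<Longrightarrow> w \<in> tangent_space M q \<Longrightarrow>
      gh q u w = exp (2 * F q) * gb q u w"
    and preserving: "\<And>q u w. u \<in> D q \<Longrightarrow> w \<in> D q \<Longrightarrow> gb q u w = g q u w"
    using metric modification
    unfolding riemannian_metric_def conformal_modification_def preserving_modification_def by auto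
  \<comment> \<open>The factor \<open>exp (2 * F q)\<close> never vanishes, so \<open>gb\<close>
    inherits nondegeneracy from \<open>gh\<close>.\<close>
  have nondeg: "nondegenerate_on (tangent_space M q) (gb q)" for q
    using pseudo_metric unfolding pseudo_riemannian_metric_def nondegenerate_on_def by (simp add: gh)
  have local: "local_frame M U X" and U: "open U"
    using frame unfolding adapted_frame_def local_frame_def by auto
  have in_D: "X a q \<in> D q" if "a \<in> A" "q \<in> U" for a q
    using frame that unfolding adapted_frame_def by (metis imageI span_base)
  have in_orth: "X i q \<in> orthogonal_distribution M g D q" if "i \<in> - A" "q \<in> U" for i q
    using frame that unfolding adapted_frame_def by (metis imageI span_base)
  have coeff_A: "metric_coeff gb X q a b = metric_coeff g X q a b"
    if "a \<in> A" "b \<in> A" "q \<in> U" for a b q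
    using preserving in_D that by (simp add: metric_coeff_def)
  have coeff_mixed: "metric_coeff g X q i a = 0" "metric_coeff g X q a i = 0"
    if "a \<in> A" "i \<in> - A" "q \<in> U" for a i q
  proof -
    show "metric_coeff g X q i a = 0"
      using in_orth in_D that by (simp add: orthogonal_distribution_def metric_coeff_def)
    then show "metric_coeff g X q a i = 0"
      using metric_coeff_commute[OF g local that(3)] by simp
  qed
  have split: "(\<Sum>\<gamma>\<in>UNIV. f \<gamma>) = (\<Sum>i\<in>- A. f i) + (\<Sum>a\<in>A. f a)" for f :: "'n \<Rightarrow> real"
    using sum.subset_diff[of A UNIV f] by (simp add: Compl_eq_Diff_UNIV)
  \<comment> \<open>The two systems are compared at one fixed point \<open>q\<close> and one fixed
    velocity \<open>v\<close>.\<close>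
  have "((\<forall>a\<in>A.
           (\<Sum>b\<in>A. \<Sum>c\<in>A. christoffel N X q a b c * v b * v c) =
           (\<Sum>b\<in>A. \<Sum>c\<in>A. christoffel Nb X q a b c * v b * v c)
           + (\<Sum>c\<in>A. X c q F * v c * v a)
           - (\<Sum>b\<in>A. \<Sum>c\<in>A. \<Sum>\<alpha>\<in>UNIV.
                metric_coeff g X q b c * inverse_metric_coeff gb X q \<alpha> a * X \<alpha> q F * v b * v c)) \<and>
        (\<forall>i\<in>-A.
           0 = (\<Sum>b\<in>A. \<Sum>c\<in>A. christoffel Nb X q i b c * v b * v c)
             - (\<Sum>b\<in>A. \<Sum>c\<in>A. \<Sum>\<alpha>\<in>UNIV.
                  metric_coeff g X q b c * inverse_metric_coeff gb X q \<alpha> i * X \<alpha> q F * v b * v c)))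
     \<longleftrightarrow> ((\<forall>c\<in>A.
           (\<Sum>a\<in>A. \<Sum>b\<in>A. \<Sum>d\<in>A. metric_coeff g X q b d *
              (kronecker a d * X c q F - kronecker c d * X a q F) * v a * v b)
           + (\<Sum>k\<in>-A. \<Sum>a\<in>A.
                modification_momentum gb X A k q v * bracket_coeff M X q k a c * v a) = 0) \<and>
        (\<forall>i\<in>-A.
           nonholonomic_field N X A (modification_momentum gb X A i) q v
           + lagrange_multiplier g N X A i q v
           + (\<Sum>k\<in>-A. \<Sum>a\<in>A. modification_momentum gb X A k q v *
                (bracket_coeff M X q k i a + kronecker k i * X a q F) * v a)
           - (\<Sum>a\<in>A. \<Sum>b\<in>A. metric_coeff g X q a b * X i q F * v a * v b) = 0))"
    (is "((\<forall>a\<in>A. ?\<Gamma>' a = ?\<Gamma>b' a + ?vF a - ?gF a) \<and> (\<forall>i\<in>- A. 0 = ?\<Gamma>b' i - ?gF i))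
      \<longleftrightarrow> ((\<forall>c\<in>A. ?A' c = 0) \<and> (\<forall>i\<in>- A. ?B' i = 0))")
    if q: "q \<in> U" for q and v :: "'n \<Rightarrow> real"
  proof -
    define \<Gamma> where "\<Gamma> \<gamma> = (\<Sum>b\<in>A. \<Sum>c\<in>A. christoffel N X q \<gamma> b c * v b * v c)" for \<gamma>
    define \<Gamma>b where "\<Gamma>b \<gamma> = (\<Sum>b\<in>A. \<Sum>c\<in>A. christoffel Nb X q \<gamma> b c * v b * v c)" for \<gamma>
    define G where "G \<alpha> \<beta> = metric_coeff gb X q \<alpha> \<beta>" for \<alpha> \<beta>
    define G' where "G' \<alpha> \<beta> = inverse_metric_coeff gb X q \<alpha> \<beta>" for \<alpha> \<beta>
    define h where "h = (\<Sum>b\<in>A. \<Sum>c\<in>A. metric_coeff g X q b c * v b * v c)"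
    define \<theta> where "\<theta> \<gamma> = modification_momentum gb X A \<gamma> q v" for \<gamma>
    define \<eta> where "\<eta> \<gamma> = modification_momentum g X A \<gamma> q v" for \<gamma>
    define VF where "VF = (\<Sum>c\<in>A. X c q F * v c)"
    \<comment> \<open>Right side minus left side of the first system. The \<open>if\<close> merges
      its two lines: only indices in \<open>A\<close> carry \<open>\<Gamma>\<close> and the term
      with \<open>VF\<close>. The factor \<open>h\<close> is twice the kinetic energy.\<close>
    define E where "E \<gamma> = \<Gamma>b \<gamma> + (if \<gamma> \<in> A then VF * v \<gamma> - \<Gamma> \<gamma> else 0)
      - h * (\<Sum>\<alpha>\<in>UNIV. G' \<alpha> \<gamma> * X \<alpha> q F)" for \<gamma>
    \<comment> \<open>This will be \<open>E\<close> with its index lowered by \<open>gb\<close>; the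
      inverse metric has cancelled in the last term.\<close>
    define L where "L \<delta> = (\<Sum>\<gamma>\<in>UNIV. \<Gamma>b \<gamma> * G \<gamma> \<delta>) + VF * \<theta> \<delta> - (\<Sum>d\<in>A. \<Gamma> d * G d \<delta>)
      - h * X \<delta> q F" for \<delta>
    \<comment> \<open>Names for the Koszul terms: \<open>P\<close> and \<open>Pb\<close>
      differentiate along the velocity, \<open>Q\<close> differentiates along
      \<open>X \<delta>\<close>, and \<open>S\<close> and \<open>T\<close> are the bracket terms
      with momenta indexed by \<open>A\<close> and by its complement.\<close>
    define P where "P \<delta> = (\<Sum>a\<in>A. \<Sum>b\<in>A. v a * v b * X a q (\<lambda>p. metric_coeff g X p b \<delta>))" for \<delta>
    define Pb where "Pb \<delta> = (\<Sum>a\<in>A. \<Sum>b\<in>A. v a * v b * X a q (\<lambda>p. metric_coeff gb X p b \<delta>))" for \<delta>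
    define Q where "Q \<delta> = (\<Sum>a\<in>A. \<Sum>b\<in>A. v a * v b * X \<delta> q (\<lambda>p. metric_coeff g X p a b)) / 2" for \<delta>
    define S where "S \<delta> = (\<Sum>d\<in>A. \<Sum>a\<in>A. \<eta> d * bracket_coeff M X q d a \<delta> * v a)" for \<delta>
    define T where "T \<delta> = (\<Sum>k\<in>- A. \<Sum>a\<in>A. \<theta> k * bracket_coeff M X q k a \<delta> * v a)" for \<delta>
    have tangent: "X \<alpha> q \<in> tangent_space M q" for \<alpha>
      by (rule local_frame_in_tangent_space[OF local q])

    \<comment> \<open>Comparison of the Koszul terms of \<open>g\<close> and
      \<open>gb\<close>\<close>
    have \<theta>_A: "\<theta> c = \<eta> c" if "c \<in> A" for c
      using that coeff_A q by (simp add: \<theta>_def \<eta>_def modification_momentum_def)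
    have \<eta>_compl: "\<eta> i = 0" if "i \<in> - A" for i
      using that coeff_mixed q by (simp add: \<eta>_def modification_momentum_def)
    \<comment> \<open>Derivatives can be compared because the coefficients agree on all of the open
      set \<open>U\<close>, not merely at \<open>q\<close>.\<close>
    have P_A: "Pb c = P c" if "c \<in> A" for c
    proof -
      have "X a q (\<lambda>p. metric_coeff gb X p b c) = X a q (\<lambda>p. metric_coeff g X p b c)"
        if "b \<in> A" for a b
        by (rule tangent_space_cong[OF tangent U q]) (rule coeff_A[OF that \<open>c \<in> A\<close>])
      then show ?thesis
        by (simp add: P_def Pb_def)
    qed
    have P_compl: "P i = 0" if "i \<in> - A" for i
    proof -
      have "X a q (\<lambda>p. metric_coeff g X p b i) = X a q (\<lambda>p. 0)" if "b \<in> A" for a b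
        by (rule tangent_space_cong[OF tangent U q]) (rule coeff_mixed(2)[OF that \<open>i \<in> - A\<close>])
      then show ?thesis
        by (simp add: P_def tangent_space_zero_fun[OF tangent])
    qed
    have Q_gb: "(\<Sum>a\<in>A. \<Sum>b\<in>A. v a * v b * X \<delta> q (\<lambda>p. metric_coeff gb X p a b)) / 2 = Q \<delta>" for \<delta>
    proof -
      have "X \<delta> q (\<lambda>p. metric_coeff gb X p a b) = X \<delta> q (\<lambda>p. metric_coeff g X p a b)"
        if "a \<in> A" "b \<in> A" for a b
        by (rule tangent_space_cong[OF tangent U q]) (rule coeff_A[OF that])
      then show ?thesis
        by (simp add: Q_def)
    qed
    have koszul_g: "(\<Sum>\<gamma>\<in>UNIV. \<Gamma> \<gamma> * metric_coeff g X q \<gamma> \<delta>) = P \<delta> - S \<delta> - Q \<delta>" for \<delta>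
    proof -
      \<comment> \<open>For \<open>g\<close> the complementary momenta vanish, so only
        \<open>S\<close> survives.\<close>
      have "(\<Sum>\<gamma>\<in>UNIV. \<Sum>a\<in>A. \<eta> \<gamma> * bracket_coeff M X q \<gamma> a \<delta> * v a) = S \<delta>"
        unfolding split S_def by (simp add: \<eta>_compl)
      then show ?thesis
        using koszul_quadratic[OF g connection local q, where A = A and v = v and \<delta> = \<delta>]
        by (simp only: \<Gamma>_def P_def Q_def \<eta>_def)
    qed
    have koszul_gb: "(\<Sum>\<gamma>\<in>UNIV. \<Gamma>b \<gamma> * G \<gamma> \<delta>) = Pb \<delta> - (T \<delta> + S \<delta>) - Q \<delta>" for \<delta>
    proof -
      \<comment> \<open>For \<open>gb\<close> the momenta along the distribution are those of
        \<open>g\<close>, which gives the same \<open>S\<close>; the additional term is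
        \<open>T\<close>.\<close>
      have "(\<Sum>\<gamma>\<in>UNIV. \<Sum>a\<in>A. \<theta> \<gamma> * bracket_coeff M X q \<gamma> a \<delta> * v a) = T \<delta> + S \<delta>"
        unfolding split S_def T_def by (simp add: \<theta>_A)
      then show ?thesis
        using koszul_quadratic[OF gb connection_bar local q, where A = A and v = v and \<delta> = \<delta>]
        by (simp only: \<Gamma>b_def Pb_def Q_gb \<theta>_def G_def)
    qed

    \<comment> \<open>Condition (A') and the components of \<open>L\<close> along the
      distribution\<close>
    have "A' + L c = 0" if "c \<in> A" "A' = ?A' c" for c A'
    proof -
      have "(\<Sum>d\<in>A. metric_coeff g X q b d * (kronecker a d * X c q F - kronecker c d * X a q F)) =
          metric_coeff g X q b a * X c q F - metric_coeff g X q b c * X a q F"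
        if "a \<in> A" for a b
        using that \<open>c \<in> A\<close>
        by (simp add: right_diff_distrib sum_subtractf sum_kronecker flip: mult.assoc sum_distrib_right)
      note contract = this[THEN arg_cong, of _ "\<lambda>x. x * v _ * v _", unfolded sum_distrib_right]
      have "(\<Sum>a\<in>A. \<Sum>b\<in>A. \<Sum>d\<in>A. metric_coeff g X q b d *
          (kronecker a d * X c q F - kronecker c d * X a q F) * v a * v b) =
        (\<Sum>a\<in>A. \<Sum>b\<in>A. (metric_coeff g X q b a * X c q F - metric_coeff g X q b c * X a q F) * v a * v b)"
        by (intro sum.cong refl contract)
      also have "\<dots> = h * X c q F - VF * \<eta> c"
      proof -
        have "h = (\<Sum>a\<in>A. \<Sum>b\<in>A. metric_coeff g X q b a * v a * v b)"
          unfolding h_def by (intro sum.cong refl) (simp add: metric_coeff_commute[OF g local q])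
        then show ?thesis
          unfolding VF_def \<eta>_def modification_momentum_def sum_product
          by (simp add: sum_distrib_left sum_subtractf algebra_simps)
      qed
      finally have "A' = h * X c q F - VF * \<eta> c + T c"
        using that(2) by (simp add: T_def \<theta>_def)
      \<comment> \<open>Since the mixed coefficients of \<open>g\<close> vanish, the sum over
        \<open>A\<close> is already the full Koszul sum of \<open>g\<close>. Its terms
        \<open>P\<close>, \<open>S\<close> and \<open>Q\<close> then cancel against those of
        \<open>gb\<close> in \<open>L\<close>.\<close>
      moreover have "(\<Sum>d\<in>A. \<Gamma> d * G d c) = P c - S c - Q c"
        using koszul_g[of c] that(1) q unfolding split by (simp add: coeff_A coeff_mixed G_def)
      ultimately show ?thesis
        using that(1) by (simp add: L_def koszul_gb P_A \<theta>_A)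
    qed
    then have A': "?A' c = 0 \<longleftrightarrow> L c = 0" if "c \<in> A" for c
      using that by fastforce

    \<comment> \<open>Condition (B') and the complementary components of \<open>L\<close>\<close>
    have B': "?B' i = L i" if i: "i \<in> - A" for i
    proof -
      have "X a q (\<lambda>p. modification_momentum gb X A i p v) =
          (\<Sum>b\<in>A. v b * X a q (\<lambda>p. metric_coeff gb X p b i))" for a
        using tangent_space_sum_fun[OF manifold tangent U q,
            where B = A and f = "\<lambda>b p. metric_coeff gb X p b i" and c = v]
        by (simp add: modification_momentum_def smooth_metric_coeff[OF gb local] mult.commute)
      then have "(\<Sum>a\<in>A. v a * X a q (\<lambda>p. modification_momentum gb X A i p v)) = Pb i"
        by (simp add: Pb_def sum_distrib_left mult.assoc)
      moreover have "deriv (\<lambda>t. modification_momentum gb X A i q (v(d := t))) (v d) = G d i"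
        if "d \<in> A" for d
      proof (rule DERIV_imp_deriv)
        \<comment> \<open>Splitting off the index \<open>d\<close> shows an affine function of
          \<open>t\<close> with slope \<open>G d i\<close>.\<close>
        have "modification_momentum gb X A i q (v(d := t)) =
            G d i * t + (\<Sum>a\<in>A - {d}. G a i * v a)" for t
          using that by (simp add: modification_momentum_def G_def sum.remove[of A d])
        then show "((\<lambda>t. modification_momentum gb X A i q (v(d := t))) has_field_derivative G d i)
            (at (v d))"
          by (auto intro!: derivative_eq_intros)
      qed
      ultimately have "nonholonomic_field N X A (modification_momentum gb X A i) q v =
          Pb i - (\<Sum>d\<in>A. \<Gamma> d * G d i)"
        by (simp add: nonholonomic_field_def \<Gamma>_def)
      moreover have "lagrange_multiplier g N X A i q v = - S i - Q i"
      proof -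
        \<comment> \<open>The multiplier is again a full Koszul sum of \<open>g\<close>, as the
          terms over \<open>A\<close> carry vanishing mixed coefficients; the term
          \<open>P i\<close> is zero for the same reason.\<close>
        have "lagrange_multiplier g N X A i q v = (\<Sum>k\<in>- A. \<Gamma> k * metric_coeff g X q k i)"
          by (simp add: lagrange_multiplier_def \<Gamma>_def sum_distrib_left sum_distrib_right mult_ac)
        then show ?thesis
          using koszul_g[of i] i q unfolding split by (simp add: P_compl coeff_mixed)
      qed
      moreover have "(\<Sum>k\<in>- A. \<Sum>a\<in>A. \<theta> k *
          (bracket_coeff M X q k i a + kronecker k i * X a q F) * v a) = VF * \<theta> i - T i"
      proof -
        have "(\<Sum>k\<in>- A. \<Sum>a\<in>A. \<theta> k * (kronecker k i * X a q F) * v a) =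
            (\<Sum>k\<in>- A. VF * \<theta> k * kronecker k i)"
          by (simp add: VF_def sum_distrib_left mult_ac)
        also have "\<dots> = VF * \<theta> i"
          using i by (simp add: sum_kronecker)
        \<comment> \<open>Antisymmetry of the bracket coefficients produces the minus sign before
          \<open>T i\<close>.\<close>
        finally show ?thesis
          by (simp add: T_def bracket_coeff_antisym[OF connection local q, of _ i]
              right_diff_distrib left_diff_distrib sum_subtractf)
      qed
      moreover have "(\<Sum>a\<in>A. \<Sum>b\<in>A. metric_coeff g X q a b * X i q F * v a * v b) = h * X i q F"
        by (simp add: h_def sum_distrib_left mult_ac)
      ultimately show ?thesis
        by (simp add: L_def koszul_gb flip: \<theta>_def)
    qed

    \<comment> \<open>Lowering and raising indices with \<open>gb\<close>\<close>
    have matrix: "matrix_inv (\<chi> \<alpha> \<beta>. G \<alpha> \<beta>) = (\<chi> \<alpha> \<beta>. G' \<alpha> \<beta>)"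
      by (simp add: G_def G'_def inverse_metric_coeff_def vec_eq_iff)
    note inv = matrix_inv_metric_coeff[OF gb nondeg local q, folded G_def, unfolded matrix]
    have inv_left: "(\<Sum>\<gamma>\<in>UNIV. G' \<alpha> \<gamma> * G \<gamma> \<beta>) = kronecker \<alpha> \<beta>" for \<alpha> \<beta>
      using arg_cong[OF inv(1), of "\<lambda>B. B $ \<alpha> $ \<beta>"] 
      by (simp add: matrix_matrix_mult_def mat_def kronecker_def)
    have inv_right: "(\<Sum>\<gamma>\<in>UNIV. G \<alpha> \<gamma> * G' \<gamma> \<beta>) = kronecker \<alpha> \<beta>" for \<alpha> \<beta>
      using arg_cong[OF inv(2), of "\<lambda>B. B $ \<alpha> $ \<beta>"] 
      by (simp add: matrix_matrix_mult_def mat_def kronecker_def)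
    have E_lower: "(\<Sum>\<gamma>\<in>UNIV. E \<gamma> * G \<gamma> \<delta>) = L \<delta>" for \<delta>
    proof -
      have "(\<Sum>\<gamma>\<in>UNIV. (\<Sum>\<alpha>\<in>UNIV. G' \<alpha> \<gamma> * X \<alpha> q F) * G \<gamma> \<delta>) =
          (\<Sum>\<alpha>\<in>UNIV. X \<alpha> q F * (\<Sum>\<gamma>\<in>UNIV. G' \<alpha> \<gamma> * G \<gamma> \<delta>))"
        unfolding sum_distrib_left sum_distrib_right
        by (subst sum.swap) (simp add: mult_ac)
      also have "\<dots> = X \<delta> q F"
        by (simp add: inv_left sum_kronecker)
      finally have "(\<Sum>\<gamma>\<in>UNIV. h * (\<Sum>\<alpha>\<in>UNIV. G' \<alpha> \<gamma> * X \<alpha> q F) * G \<gamma> \<delta>) = h * X \<delta> q F"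
        unfolding mult.assoc sum_distrib_left[symmetric] by (rule arg_cong)
      moreover have "(\<Sum>\<gamma>\<in>UNIV. (if \<gamma> \<in> A then VF * v \<gamma> - \<Gamma> \<gamma> else 0) * G \<gamma> \<delta>) =
          VF * \<theta> \<delta> - (\<Sum>d\<in>A. \<Gamma> d * G d \<delta>)"
        unfolding split
        by (simp add: \<theta>_def modification_momentum_def G_def sum_distrib_left
            sum_subtractf algebra_simps)
      ultimately show ?thesis
        by (simp add: E_def L_def left_diff_distrib distrib_right sum.distrib sum_subtractf)
    qed
    \<comment> \<open>The inverse law on the other side recovers \<open>E\<close> from
      \<open>L\<close>, so the two vanish together.\<close>
    have E_raise: "(\<Sum>\<delta>\<in>UNIV. L \<delta> * G' \<delta> \<gamma>) = E \<gamma>" for \<gamma>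
    proof -
      have "(\<Sum>\<delta>\<in>UNIV. L \<delta> * G' \<delta> \<gamma>) =
          (\<Sum>\<beta>\<in>UNIV. E \<beta> * (\<Sum>\<delta>\<in>UNIV. G \<beta> \<delta> * G' \<delta> \<gamma>))"
        unfolding E_lower[symmetric] sum_distrib_left sum_distrib_right
        by (subst sum.swap) (simp add: mult_ac)
      then show ?thesis
        by (simp add: inv_right sum_kronecker)
    qed
    have gF: "?gF \<gamma> = h * (\<Sum>\<alpha>\<in>UNIV. G' \<alpha> \<gamma> * X \<alpha> q F)" for \<gamma>
      by (simp add: h_def G'_def sum_distrib_right sum_distrib_left mult_ac)
    have vF: "?vF \<gamma> = VF * v \<gamma>" for \<gamma>
      by (simp add: VF_def sum_distrib_left mult_ac)
    \<comment> \<open>A case split on membership in \<open>A\<close> resolves the \<open>if\<close>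
      in \<open>E\<close> and separates the two lines of the system again.\<close>
    have "((\<forall>a\<in>A. ?\<Gamma>' a = ?\<Gamma>b' a + ?vF a - ?gF a) \<and> (\<forall>i\<in>- A. 0 = ?\<Gamma>b' i - ?gF i)) \<longleftrightarrow>
        (\<forall>\<gamma>. E \<gamma> = 0)"
      unfolding gF vF E_def \<Gamma>_def[symmetric] \<Gamma>b_def[symmetric]
      by (auto simp: algebra_simps)
    also have "\<dots> \<longleftrightarrow> (\<forall>\<delta>. L \<delta> = 0)"
    proof
      assume "\<forall>\<gamma>. E \<gamma> = 0"
      then show "\<forall>\<delta>. L \<delta> = 0"
        by (simp flip: E_lower)
    next
      assume "\<forall>\<delta>. L \<delta> = 0"
      then show "\<forall>\<gamma>. E \<gamma> = 0"
        by (simp flip: E_raise)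
    qed
    also have "\<dots> \<longleftrightarrow> ((\<forall>c\<in>A. ?A' c = 0) \<and> (\<forall>i\<in>- A. ?B' i = 0))"
      using A' B' by auto
    finally show ?thesis .
  qed
  \<comment> \<open>The pointwise equivalence is lifted through the quantifiers over
    \<open>q\<close> and \<open>v\<close>.\<close>
  then show ?thesis
    by (intro ball_cong refl arg_cong[where f = All] ext)
qed

end
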